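(* For every integer $n\ge 1$ and every cell $v$ of the $n\times n$ board, an enemy rook on $v$ can be trapped by rooks, and the minimum number of rooks needed to trap it is $n-1$.
   Context: Cells of the $n\times n$ board are $(x,y)$ with $1\le x,y\le n$. A rook attacks (can move to) every other cell having the same $x$-coordinate or the same $y$-coordinate (other pieces do not block). A set $T$ of cells not containing $v$ (the positions of the soldier rooks) traps an enemy rook on $v$ if: (1) no two distinct cells of $T\cup\{v\}$ attack each other; and (2) every cell attacked from $v$ is attacked from some cell of $T$. The number of rooks used is $|T|$. *)

theory Defs
  imports Main
begin

definition board :: "nat \<Rightarrow> (nat \<times> nat) set" where
  "board n = {1..n} \<times> {1..n}"

definition rook_attacks :: "nat \<times> nat \<Rightarrow> nat \<times> nat \<Rightarrow> bool" where
  "rook_attacks u w \<longleftrightarrow> u \<noteq> w \<and> (fst u = fst w \<or> snd u = snd w)"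

definition traps :: "nat \<Rightarrow> nat \<times> nat \<Rightarrow> (nat \<times> nat) set \<Rightarrow> bool" where
  "traps n v T \<longleftrightarrow>
     T \<subseteq> board n \<and> v \<notin> T \<and>
     (\<forall>a \<in> insert v T. \<forall>b \<in> insert v T. a \<noteq> b \<longrightarrow> \<not> rook_attacks a b) \<and>
     (\<forall>w \<in> board n. rook_attacks v w \<longrightarrow> (\<exists>t \<in> T. rook_attacks t w))"

(* LEAST is unspecified if no set traps the enemy rook, so existence has to be stated separately. *)
definition min_rooks :: "nat \<Rightarrow> nat \<times> nat \<Rightarrow> nat" where
  "min_rooks n v = (LEAST k. \<exists>T. traps n v T \<and> card T = k)"

end

theory Submission
  imports Defs "HOL-Combinatorics.Transposition"
begin

text \<open>Write \<open>v = (a, b)\<close>. A soldier rook cannot stand in the column of \<open>v\<close>, so a cell of that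
  column other than \<open>v\<close> can only be covered along its row; the \<open>n - 1\<close> such cells lie in distinct
  rows, which forces \<open>n - 1\<close> rooks (\<open>traps_card_ge\<close>). Conversely, a permutation placement of \<open>n\<close>
  rooks has exactly one rook in each row and each column. If it contains \<open>v\<close>, deleting \<open>v\<close> leaves
  a rook in every column and every row except those of \<open>v\<close>, and these rooks trap \<open>v\<close>. The
  transposition of \<open>a\<close> and \<open>b\<close> is such a permutation (\<open>traps_transpose\<close>).\<close>

text \<open>Only one of the two lines through \<open>v\<close> is needed: a rook covering \<open>(fst v, j)\<close> along the
  column would itself attack \<open>v\<close>, so it stands in row \<open>j\<close>, and different \<open>j\<close> need different
  rooks.\<close>

lemma traps_card_ge:
  assumes T: "traps n v T" and v: "v \<in> board n"
  shows "n - 1 \<le> card T"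
proof -
  have fin: "finite T"
    using T by (auto simp: traps_def board_def intro: finite_subset)
  have "{1..n} - {snd v} \<subseteq> snd ` T"
  proof
    fix j assume j: "j \<in> {1..n} - {snd v}"
    have "(fst v, j) \<in> board n" "rook_attacks v (fst v, j)"
      using j v by (auto simp: board_def rook_attacks_def prod_eq_iff)
    then obtain t where t: "t \<in> T" "rook_attacks t (fst v, j)"
      using T unfolding traps_def by blast
    have "t \<noteq> v" "\<not> rook_attacks v t"
      using T t(1) unfolding traps_def by auto
    hence "fst t \<noteq> fst v"
      by (auto simp: rook_attacks_def)
    with t(2) have "snd t = j"
      by (auto simp: rook_attacks_def)
    with t(1) show "j \<in> snd ` T" by blast
  qed
  hence "card ({1..n} - {snd v}) \<le> card T"
    using fin by (meson card_image_le card_mono finite_imageI le_trans)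
  moreover have "card ({1..n} - {snd v}) = n - 1"
    using v by (auto simp: board_def)
  ultimately show ?thesis by simp
qed

text \<open>Any permutation sending \<open>a\<close> to \<open>b\<close> would do; the transposition is convenient because it is
  its own inverse, so the rook in row \<open>j\<close> stands in column \<open>transpose a b j\<close>.\<close>

lemma traps_transpose:
  assumes "a \<in> {1..n}" and "b \<in> {1..n}"
  shows "traps n (a, b) ((\<lambda>x. (x, transpose a b x)) ` ({1..n} - {a}))"
    (is "traps n ?v ?T")
  unfolding traps_def
proof (intro conjI ballI impI)
  show "?T \<subseteq> board n"
    using assms by (auto simp: board_def transpose_def)
  show "?v \<notin> ?T" by auto
next
  fix c d assume cd: "c \<in> insert ?v ?T" "d \<in> insert ?v ?T" "c \<noteq> d"
  have "snd w = transpose a b (fst w)" if "w \<in> insert ?v ?T" for w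
    using that by auto
  with cd show "\<not> rook_attacks c d"
    by (metis prod_eq_iff rook_attacks_def transpose_involutory)
next
  fix w assume w: "w \<in> board n" "rook_attacks ?v w"
  obtain i j where [simp]: "w = (i, j)" by (cases w)
  have ij: "i \<in> {1..n}" "j \<in> {1..n}"
    using w(1) by (auto simp: board_def)
  show "\<exists>t\<in>?T. rook_attacks t w"
  proof (cases "i = a")
    case True
    with w(2) have "j \<noteq> b" by (auto simp: rook_attacks_def)
    hence x: "transpose a b j \<noteq> a" by (auto simp: transpose_def)
    moreover have "transpose a b j \<in> {1..n}"
      using assms ij by (auto simp: transpose_def)
    ultimately have "(transpose a b j, j) \<in> ?T"
      by (force simp: image_iff)
    moreover have "rook_attacks (transpose a b j, j) w"
      using x True by (simp add: rook_attacks_def)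
    ultimately show ?thesis by blast
  next
    case False
    with w(2) have "j = b" by (auto simp: rook_attacks_def)
    moreover have "transpose a b i \<noteq> b"
      using False by (auto simp: transpose_def)
    ultimately have "rook_attacks (i, transpose a b i) w"
      by (simp add: rook_attacks_def)
    with False ij show ?thesis by blast
  qed
qed

theorem mainTheorem9:
  fixes n :: nat and v :: "nat \<times> nat"
  assumes "n \<ge> 1" and "v \<in> board n"
  shows "(\<exists>T. traps n v T) \<and> min_rooks n v = n - 1"
proof -
  obtain a b where v: "v = (a, b)" and ab: "a \<in> {1..n}" "b \<in> {1..n}"
    using assms(2) by (auto simp: board_def)
  define T where "T = (\<lambda>x. (x, transpose a b x)) ` ({1..n} - {a})"
  have T: "traps n v T"
    unfolding v T_def by (rule traps_transpose[OF ab])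
  have "card T = card ({1..n} - {a})"
    unfolding T_def by (rule card_image) (auto simp: inj_on_def)
  hence "card T = n - 1" using ab by simp
  with T have "min_rooks n v = n - 1"
    unfolding min_rooks_def
    by (intro Least_equality) (use traps_card_ge assms(2) in blast)+
  with T show ?thesis by blast
qed

end
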